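(* Let $\lambda_1,\lambda_2,\lambda_3,\mu\in\mathbb{R}$ be pairwise distinct and $\mathfrak{p}=\{(\lambda_1,1),(\lambda_2,1),(\lambda_3,1),(\mu,4)\}$. Then the set of block diagonal matrices $$\left\{\operatorname{diag}(\lambda_1,\lambda_2,D,\mu\mathbb{I}_3)\ \Big|\ D=R_\alpha^{-1}\begin{pmatrix}\lambda_3&0\\0&\mu\end{pmatrix}R_\alpha,\ \alpha\in\left[0,\tfrac{\pi}{2}\right]\right\}$$ is a cross-section for $\mathrm{Sym}_{\mathfrak{p}}/\mathcal{G}_2$.
   Context: $R_\alpha=\begin{pmatrix}\cos\alpha&-\sin\alpha\\ \sin\alpha&\cos\alpha\end{pmatrix}$; $\operatorname{diag}(\cdot)$ denotes the block diagonal matrix with the listed blocks. Let $V$ be a 7-dimensional Euclidean space with a vector product $\pi$, i.e. a linear map $\pi:V\wedge V\to V$ such that $\{u,v,\pi(u\wedge v)\}$ is orthonormal whenever $\{u,v\}\subset V$ is. Write $xy=\pi(x\wedge y)$. Let $\mathcal{G}_2=\mathrm{Aut}(\pi)$ be the group of all orthogonal linear maps $g:V\to V$ with $g(xy)=g(x)g(y)$ for all $x,y\in V$. A Cayley triple is a triple $(u,v,z)\in V^3$ such that $\{u,v,uv,z\}$ is orthonormal; it determines an orthonormal basis $(u,v,uv,z,uz,vz,(uv)z)$ of $V$. Fix a Cayley triple $s$, and for a symmetric endomorphism $\delta$ of $V$ let $[\delta]_s$ be its matrix in the basis determined by $s$; $\delta\mapsto[\delta]_s$ is a bijection $\mathrm{Sym}(V)\to\mathrm{Sym}(\mathbb{R}^7)$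 from symmetric endomorphisms of $V$ to real symmetric $7\times7$-matrices. $\mathcal{G}_2$ acts on $\mathrm{Sym}(\mathbb{R}^7)$ by $[\delta]_s\cdot g=[g^{-1}\delta g]_s$. For a symmetric matrix $\delta$ let $\mathfrak{p}(\delta)=\{(\lambda,\dim\mathcal{E}_\lambda(\delta))\mid\lambda\text{ an eigenvalue of }\delta\}$, where $\mathcal{E}_\lambda(\delta)$ is the eigenspace of $\lambda$, and for a set $\mathfrak{p}$ of such pairs let $\mathrm{Sym}_{\mathfrak{p}}=\{\delta\in\mathrm{Sym}(\mathbb{R}^7)\mid\mathfrak{p}(\delta)=\mathfrak{p}\}$, which is invariant under the action. A cross-section for $\mathrm{Sym}_{\mathfrak{p}}/\mathcal{G}_2$ is a subset of $\mathrm{Sym}_{\mathfrak{p}}$ containing exactly one element of each $\mathcal{G}_2$-orbit. $\mathbb{I}_n$ is the $n\times n$ identity matrix. *)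

theory Defs
  imports "HOL-Analysis.Analysis"
begin

text \<open>Orthonormality is a property of lists, so that repeated entries are excluded.\<close>

definition orthonormal :: "'v::real_inner list \<Rightarrow> bool" where
  "orthonormal xs \<longleftrightarrow>
     (\<forall>i<length xs. \<forall>j<length xs. xs ! i \<bullet> xs ! j = (if i = j then 1 else 0))"

text \<open>A linear map on the exterior square is given as an alternating bilinear map;
  \<open>vp x y\<close> is the product \<open>xy\<close>.\<close>

definition vector_product :: "('v::euclidean_space \<Rightarrow> 'v \<Rightarrow> 'v) \<Rightarrow> bool" where
  "vector_product vp \<longleftrightarrow>
     bilinear vp \<and> (\<forall>x. vp x x = 0) \<and>
     (\<forall>u v. orthonormal [u, v] \<longrightarrow> orthonormal [u, v, vp u v])"

definition G2 :: "('v::euclidean_space \<Rightarrow> 'v \<Rightarrow> 'v) \<Rightarrow> ('v \<Rightarrow> 'v) set" where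
  "G2 vp = {g. orthogonal_transformation g \<and> (\<forall>x y. g (vp x y) = vp (g x) (g y))}"

definition cayley_triple ::
  "('v::euclidean_space \<Rightarrow> 'v \<Rightarrow> 'v) \<Rightarrow> 'v \<times> 'v \<times> 'v \<Rightarrow> bool" where
  "cayley_triple vp = (\<lambda>(u, v, z). orthonormal [u, v, vp u v, z])"

text \<open>Vectors and matrices are indexed by \<open>1, \<dots>, 7\<close> in the type \<open>7\<close>, in which \<open>7 = 0\<close>.\<close>

definition cayley_basis ::
  "('v::euclidean_space \<Rightarrow> 'v \<Rightarrow> 'v) \<Rightarrow> 'v \<times> 'v \<times> 'v \<Rightarrow> 'v ^ 7" where
  "cayley_basis vp =
     (\<lambda>(u, v, z). vector [u, v, vp u v, z, vp u z, vp v z, vp (vp u v) z])"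

definition matrix_in_basis ::
  "'v::euclidean_space ^ 'n \<Rightarrow> ('v \<Rightarrow> 'v) \<Rightarrow> real ^ 'n ^ 'n" where
  "matrix_in_basis b \<delta> =
     (\<chi> i j. representation (range (\<lambda>k. b $ k)) (\<delta> (b $ j)) (b $ i))"

definition sym_endo :: "('v::euclidean_space \<Rightarrow> 'v) set" where
  "sym_endo = {\<delta>. linear \<delta> \<and> (\<forall>x y. \<delta> x \<bullet> y = x \<bullet> \<delta> y)}"

definition sym_matrices :: "(real ^ 'n ^ 'n) set" where
  "sym_matrices = {A. transpose A = A}"

text \<open>The right action \<open>[\<delta>]\<^sub>s \<cdot> g = [g\<^sup>-\<^sup>1 \<delta> g]\<^sub>s\<close> on symmetric matrices, where \<open>\<delta>\<close> is recovered
  from its matrix through the bijection \<open>\<delta> \<mapsto> [\<delta>]\<^sub>s\<close>.\<close>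

definition G2_act ::
  "('v::euclidean_space \<Rightarrow> 'v \<Rightarrow> 'v) \<Rightarrow> 'v \<times> 'v \<times> 'v \<Rightarrow> real ^ 7 ^ 7 \<Rightarrow> ('v \<Rightarrow> 'v) \<Rightarrow> real ^ 7 ^ 7"
where
  "G2_act vp s A g =
     (let b = cayley_basis vp s;
          \<delta> = the_inv_into sym_endo (matrix_in_basis b) A
      in matrix_in_basis b (inv g \<circ> \<delta> \<circ> g))"

definition G2_orbit ::
  "('v::euclidean_space \<Rightarrow> 'v \<Rightarrow> 'v) \<Rightarrow> 'v \<times> 'v \<times> 'v \<Rightarrow> real ^ 7 ^ 7 \<Rightarrow> (real ^ 7 ^ 7) set" where
  "G2_orbit vp s A = {G2_act vp s A g | g. g \<in> G2 vp}"

definition eigenspace :: "real ^ 'n ^ 'n \<Rightarrow> real \<Rightarrow> (real ^ 'n) set" where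
  "eigenspace A l = {x. A *v x = l *\<^sub>R x}"

definition eigenvalue :: "real ^ 'n ^ 'n \<Rightarrow> real \<Rightarrow> bool" where
  "eigenvalue A l \<longleftrightarrow> (\<exists>x. x \<noteq> 0 \<and> A *v x = l *\<^sub>R x)"

definition spectral_type :: "real ^ 'n ^ 'n \<Rightarrow> (real \<times> nat) set" where
  "spectral_type A = {(l, dim (eigenspace A l)) | l. eigenvalue A l}"

definition sym_of_type :: "(real \<times> nat) set \<Rightarrow> (real ^ 7 ^ 7) set" where
  "sym_of_type p = {A \<in> sym_matrices. spectral_type A = p}"

definition cross_section ::
  "('v::euclidean_space \<Rightarrow> 'v \<Rightarrow> 'v) \<Rightarrow> 'v \<times> 'v \<times> 'v \<Rightarrow> (real \<times> nat) set
    \<Rightarrow> (real ^ 7 ^ 7) set \<Rightarrow> bool" where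
  "cross_section vp s p X \<longleftrightarrow>
     X \<subseteq> sym_of_type p \<and> (\<forall>Q \<in> G2_orbit vp s ` sym_of_type p. \<exists>!A. A \<in> X \<and> A \<in> Q)"

definition rot :: "real \<Rightarrow> real ^ 2 ^ 2" where
  "rot \<alpha> = vector [vector [cos \<alpha>, - sin \<alpha>],
                   vector [sin \<alpha>,   cos \<alpha>]]"

definition diag2 :: "real \<Rightarrow> real \<Rightarrow> real ^ 2 ^ 2" where
  "diag2 a b = vector [vector [a, 0],
                       vector [0, b]]"

definition block_diag :: "real \<Rightarrow> real \<Rightarrow> real ^ 2 ^ 2 \<Rightarrow> real ^ 3 ^ 3 \<Rightarrow> real ^ 7 ^ 7" where
  "block_diag a b D E = vector
    [vector [a, 0, 0,         0,         0,         0,         0],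
     vector [0, b, 0,         0,         0,         0,         0],
     vector [0, 0, D $ 1 $ 1, D $ 1 $ 2, 0,         0,         0],
     vector [0, 0, D $ 2 $ 1, D $ 2 $ 2, 0,         0,         0],
     vector [0, 0, 0,         0,         E $ 1 $ 1, E $ 1 $ 2, E $ 1 $ 3],
     vector [0, 0, 0,         0,         E $ 2 $ 1, E $ 2 $ 2, E $ 2 $ 3],
     vector [0, 0, 0,         0,         E $ 3 $ 1, E $ 3 $ 2, E $ 3 $ 3]]"

end

theory Submission
  imports Defs
begin

text \<open>
  A symmetric matrix with three simple eigenvalues \<open>l1, l2, l3\<close> and a fourth eigenvalue \<open>mu\<close> on
  the remaining eigenspace is the same as a triple of mutually orthogonal lines, that is, an
  orthonormal triple \<open>w1, w2, w3\<close> of axes up to three independent signs (\<open>matrices_of_type\<close>,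
  \<open>axis_endo_unique\<close>). An element \<open>g\<close> of \<open>G\<^sub>2\<close> acts by moving the axes by the inverse of \<open>g\<close>
  (\<open>G2_act_axis_endo\<close>). So the task is to classify orthonormal triples up to signs and
  automorphisms of the product.

  The number \<open>|\<langle>w1 w2, w3\<rangle>| \<in> [0, 1]\<close> is an invariant. It is complete: after a change of sign of
  \<open>w3\<close> it is \<open>\<langle>w1 w2, w3\<rangle> = cos \<alpha>\<close> with a unique \<open>\<alpha> \<in> [0, \<pi>/2]\<close>, and there is a unit vector
  \<open>z\<close> orthogonal to \<open>w1, w2, w1 w2\<close> such that \<open>w3 = cos \<alpha> w1 w2 - sin \<alpha> z\<close>
  (\<open>cayley_completion\<close>). Then \<open>(w1, w2, z)\<close> is a Cayley triple, and an automorphism carries the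
  fixed Cayley triple to it (\<open>G2_transitive\<close>). Hence the axes can be brought to
  \<open>u, v, cos \<alpha> uv - sin \<alpha> z\<close> with the fixed \<open>(u, v, z)\<close>, and the matrix with these axes is the
  block diagonal matrix of the theorem with parameter \<open>\<alpha>\<close> (\<open>block_diag_eq_axis_endo\<close>).

  Transitivity on Cayley triples holds because the identity \<open>x(xy) = \<langle>x, y\<rangle>x - \<langle>x, x\<rangle>y\<close> and its
  polarisation, which follow from the axioms of a vector product, determine the multiplication
  table of a Cayley basis (\<open>cayley_table\<close>).
\<close>

section \<open>Indices and vectors of length seven\<close>

lemma exhaust_7:
  fixes x :: 7
  shows "x = 1 \<or> x = 2 \<or> x = 3 \<or> x = 4 \<or> x = 5 \<or> x = 6 \<or> x = 7"
proof (induct x)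
  case (of_int z)
  then have "0 \<le> z" and "z < 7" by simp_all
  then have "z = 0 \<or> z = 1 \<or> z = 2 \<or> z = 3 \<or> z = 4 \<or> z = 5 \<or> z = 6" by arith
  then show ?case by auto
qed

lemma forall_7: "(\<forall>i::7. P i) \<longleftrightarrow> P 1 \<and> P 2 \<and> P 3 \<and> P 4 \<and> P 5 \<and> P 6 \<and> P 7"
  by (metis exhaust_7)

lemma vector_7:
  "(vector [a, b, c, d, e, f, g] :: 'a::zero ^ 7) $ 1 = a"
  "(vector [a, b, c, d, e, f, g] :: 'a::zero ^ 7) $ 2 = b"
  "(vector [a, b, c, d, e, f, g] :: 'a::zero ^ 7) $ 3 = c"
  "(vector [a, b, c, d, e, f, g] :: 'a::zero ^ 7) $ 4 = d"
  "(vector [a, b, c, d, e, f, g] :: 'a::zero ^ 7) $ 5 = e"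
  "(vector [a, b, c, d, e, f, g] :: 'a::zero ^ 7) $ 6 = f"
  "(vector [a, b, c, d, e, f, g] :: 'a::zero ^ 7) $ 7 = g"
  unfolding vector_def by simp_all

section \<open>Identities of a vector product\<close>

locale vector_product_algebra =
  fixes vp :: "'v::euclidean_space \<Rightarrow> 'v \<Rightarrow> 'v"
  assumes vector_product: "vector_product vp"
begin

lemma bilinear_vp: "bilinear vp" and vp_self: "vp x x = 0"
  using vector_product by (auto simp: vector_product_def)

lemma orthonormal_pair_vp:
  "x \<bullet> x = 1 \<Longrightarrow> y \<bullet> y = 1 \<Longrightarrow> x \<bullet> y = 0 \<Longrightarrow>
   vp x y \<bullet> x = 0 \<and> vp x y \<bullet> y = 0 \<and> vp x y \<bullet> vp x y = 1"
  using vector_product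
  by (simp add: vector_product_def orthonormal_def less_Suc_eq all_conj_distrib inner_commute
      numeral_nat)

lemmas vp_simps =
  bilinear_ladd[OF bilinear_vp] bilinear_radd[OF bilinear_vp]
  bilinear_lmul[OF bilinear_vp] bilinear_rmul[OF bilinear_vp]
  bilinear_lsub[OF bilinear_vp] bilinear_rsub[OF bilinear_vp]
  bilinear_lneg[OF bilinear_vp] bilinear_rneg[OF bilinear_vp]
  bilinear_lzero[OF bilinear_vp] bilinear_rzero[OF bilinear_vp]

lemma vp_anticommute: "vp y x = - vp x y"
proof -
  have "vp (x + y) (x + y) = 0" by (rule vp_self)
  then have "vp y x + vp x y = 0" by (simp add: vp_simps vp_self[of x] vp_self[of y])
  then show ?thesis by (simp only: eq_neg_iff_add_eq_0)
qed

text \<open>The metric axiom speaks of orthonormal pairs only; by bilinearity it scales to orthogonal pairs.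
  The next lemma then reaches all pairs, because subtracting from \<open>y\<close> its component along
  \<open>x\<close> does not change \<open>xy\<close>.\<close>

lemma orthogonal_vp:
  assumes "x \<bullet> y = 0"
  shows "vp x y \<bullet> x = 0 \<and> vp x y \<bullet> y = 0 \<and> vp x y \<bullet> vp x y = (x \<bullet> x) * (y \<bullet> y)"
proof (cases "x = 0 \<or> y = 0")
  case True
  then show ?thesis by (auto simp: vp_simps)
next
  case False
  define u v where "u = x /\<^sub>R norm x" and "v = y /\<^sub>R norm y"
  have uv: "u \<bullet> u = 1" "v \<bullet> v = 1" "u \<bullet> v = 0"
    using False assms by (auto simp: u_def v_def dot_square_norm power2_eq_square field_simps)
  have xy: "x = norm x *\<^sub>R u" "y = norm y *\<^sub>R v"
    using False by (simp_all add: u_def v_def)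
  have "vp x y = (norm x * norm y) *\<^sub>R vp u v"
    by (subst xy(1), subst xy(2)) (simp add: vp_simps)
  moreover have "x \<bullet> x = norm x * norm x" "y \<bullet> y = norm y * norm y"
    by (simp_all add: dot_square_norm power2_eq_square)
  ultimately show ?thesis
    using orthonormal_pair_vp[OF uv] xy
    by (metis (no_types, lifting) inner_scaleR_left inner_scaleR_right mult.assoc mult.commute
        mult_cancel_left mult_zero_right mult_1)
qed

lemma inner_vp_left: "vp x y \<bullet> x = 0"
  and inner_vp_right: "vp x y \<bullet> y = 0"
  and inner_vp_vp_same: "vp x y \<bullet> vp x y = (x \<bullet> x) * (y \<bullet> y) - (x \<bullet> y)\<^sup>2"
proof -
  define a where "a = (x \<bullet> y) / (x \<bullet> x)"
  define y' where "y' = y - a *\<^sub>R x"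
  have ax: "a * (x \<bullet> x) = x \<bullet> y" by (cases "x = 0") (simp_all add: a_def)
  then have "x \<bullet> y' = 0" by (simp add: y'_def inner_diff_right)
  note o = orthogonal_vp[OF this]
  have eq: "vp x y' = vp x y" by (simp add: y'_def vp_simps vp_self)
  have y: "y = y' + a *\<^sub>R x" by (simp add: y'_def)
  show l: "vp x y \<bullet> x = 0" using o eq by simp
  show "vp x y \<bullet> y = 0" using o l unfolding eq by (subst y) (simp add: inner_add_right)
  have "y' \<bullet> y' = y \<bullet> y - 2 * a * (x \<bullet> y) + a * (a * (x \<bullet> x))"
    by (simp add: y'_def inner_simps inner_commute algebra_simps)
  then have "(x \<bullet> x) * (y' \<bullet> y') = (x \<bullet> x) * (y \<bullet> y) - (x \<bullet> y)\<^sup>2"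
    using ax by (simp add: power2_eq_square) algebra
  then show "vp x y \<bullet> vp x y = (x \<bullet> x) * (y \<bullet> y) - (x \<bullet> y)\<^sup>2" using o eq by simp
qed

lemma inner_vp_left': "x \<bullet> vp x y = 0" and inner_vp_right': "y \<bullet> vp x y = 0"
  using inner_vp_left inner_vp_right by (simp_all add: inner_commute)

text \<open>Polarising \<open>\<langle>xy, y\<rangle> = 0\<close> in \<open>y\<close>: the trilinear form \<open>\<langle>xy, z\<rangle>\<close> is alternating.\<close>

lemma inner_vp_swap: "vp x y \<bullet> z = - (vp x z \<bullet> y)"
proof -
  have "vp x (y + z) \<bullet> (y + z) = 0" by (rule inner_vp_right)
  then show ?thesis by (simp add: vp_simps inner_simps inner_vp_right)
qed

lemma inner_vp_cycle: "vp x y \<bullet> z = vp y z \<bullet> x"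
  by (metis inner_minus_left inner_vp_swap vp_anticommute)

lemma inner_vp_vp: "vp x y \<bullet> vp x z = (x \<bullet> x) * (y \<bullet> z) - (x \<bullet> y) * (x \<bullet> z)"
  using inner_vp_vp_same[of x "y + z"] inner_vp_vp_same[of x y] inner_vp_vp_same[of x z]
  by (simp add: vp_simps inner_simps inner_commute[of z y] inner_commute[of "vp x z" "vp x y"]
      power2_eq_square algebra_simps)

text \<open>By the alternation of \<open>\<langle>xy, z\<rangle>\<close>, left multiplication by \<open>x\<close> is skew, so its square is
  determined by the inner products of its values, which \<open>inner_vp_vp\<close> computes.\<close>

lemma vp_vp_same: "vp x (vp x y) = (x \<bullet> y) *\<^sub>R x - (x \<bullet> x) *\<^sub>R y"
proof (rule vector_eq_ldot[THEN iffD1, rule_format])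
  fix z
  have "z \<bullet> vp x (vp x y) = - (vp x y \<bullet> vp x z)"
    by (metis inner_commute inner_vp_swap)
  then show "z \<bullet> vp x (vp x y) = z \<bullet> ((x \<bullet> y) *\<^sub>R x - (x \<bullet> x) *\<^sub>R y)"
    by (simp add: inner_vp_vp inner_simps inner_commute)
qed

lemma vp_vp_polarised:
  "vp x (vp y z) + vp y (vp x z) = (x \<bullet> z) *\<^sub>R y + (y \<bullet> z) *\<^sub>R x - (2 * (x \<bullet> y)) *\<^sub>R z"
  using vp_vp_same[of "x + y" z]
  by (simp add: vp_simps vp_vp_same inner_simps inner_commute[of y x] algebra_simps)

text \<open>Together with \<open>x(xy) = -y\<close> for a unit vector \<open>x\<close> orthogonal to \<open>y\<close>, the following three
  rules, which come from the polarised identity, evaluate every nested product of elements of a Cayley basis. Their hypotheses are orthogonality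
  and unit length, which the basis supplies for compound elements such as \<open>uz\<close> as well.\<close>

lemma vp_vp_orthogonal:
  assumes "x \<bullet> y = 0" "x \<bullet> z = 0" "y \<bullet> z = 0"
  shows "vp x (vp y z) = - vp y (vp x z)"
  using vp_vp_polarised[of x y z] assms by (simp add: add_eq_0_iff2)

lemma vp_vp_assoc:
  assumes "x \<bullet> y = 0" "x \<bullet> z = 0" "y \<bullet> z = 0"
  shows "vp x (vp y z) = - vp (vp x y) z"
  using vp_vp_orthogonal[of x z y] assms
  by (metis inner_commute vp_anticommute vp_simps(8) minus_minus)

lemma vp_vp_common_right:
  assumes "x \<bullet> y = 0" "x \<bullet> z = 0" "y \<bullet> z = 0" "z \<bullet> z = 1" "y \<bullet> vp x z = 0"
  shows "vp (vp x z) (vp y z) = - vp x y"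
proof -
  have "vp (vp x z) (vp y z) = - vp y (vp (vp x z) z)"
    using assms by (intro vp_vp_orthogonal) (simp_all add: inner_vp_right' inner_commute)
  also have "vp (vp x z) z = - x"
    using vp_vp_same[of z x] vp_anticommute[of z x] vp_anticommute[of z "vp x z"] assms
    by (simp add: vp_simps inner_vp_right' inner_commute[of z x])
  finally show ?thesis by (simp add: vp_simps vp_anticommute[of x y])
qed

section \<open>Cayley bases\<close>

lemma cayley_triple_iff:
  "cayley_triple vp (u, v, z) \<longleftrightarrow>
     u \<bullet> u = 1 \<and> v \<bullet> v = 1 \<and> z \<bullet> z = 1 \<and> u \<bullet> v = 0 \<and> u \<bullet> z = 0 \<and> v \<bullet> z = 0 \<and> vp u v \<bullet> z = 0"
  using orthonormal_pair_vp[of u v]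
  by (auto simp: cayley_triple_def orthonormal_def less_Suc_eq all_conj_distrib inner_commute
      numeral_nat)

lemma cayley_basis_nth:
  "cayley_basis vp (u, v, z) $ 1 = u" "cayley_basis vp (u, v, z) $ 2 = v"
  "cayley_basis vp (u, v, z) $ 3 = vp u v" "cayley_basis vp (u, v, z) $ 4 = z"
  "cayley_basis vp (u, v, z) $ 5 = vp u z" "cayley_basis vp (u, v, z) $ 6 = vp v z"
  "cayley_basis vp (u, v, z) $ 7 = vp (vp u v) z"
  by (simp_all add: cayley_basis_def vector_7)

lemma cayley_basis_inner:
  assumes "cayley_triple vp s"
  shows "cayley_basis vp s $ i \<bullet> cayley_basis vp s $ j = (if i = j then 1 else 0)"
proof -
  obtain u v z where s: "s = (u, v, z)" by (cases s) auto
  have t: "u \<bullet> u = 1" "v \<bullet> v = 1" "z \<bullet> z = 1" "u \<bullet> v = 0" "u \<bullet> z = 0" "v \<bullet> z = 0" "vp u v \<bullet> z = 0"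
    using assms by (auto simp: s cayley_triple_iff)
  have t': "v \<bullet> u = 0" "z \<bullet> u = 0" "z \<bullet> v = 0" "z \<bullet> vp u v = 0"
    using t by (simp_all add: inner_commute)
  define b where "b = cayley_basis vp s"
  have b: "b $ 1 = u" "b $ 2 = v" "b $ 3 = vp u v" "b $ 4 = z" "b $ 5 = vp u z" "b $ 6 = vp v z"
    "b $ 7 = vp (vp u v) z"
    by (simp_all add: b_def s cayley_basis_nth)
  have norms: "vp u v \<bullet> vp u v = 1" "vp u z \<bullet> vp u z = 1" "vp v z \<bullet> vp v z = 1"
    "vp (vp u v) z \<bullet> vp (vp u v) z = 1"
    using t by (simp_all add: inner_vp_vp)
  \<comment> \<open>Right multiplication by the unit vector \<open>z\<close> is isometric on the complement of \<open>z\<close>.\<close>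
  have right: "vp x z \<bullet> vp y z = x \<bullet> y" if "x \<bullet> z = 0" for x y
    using inner_vp_vp[of z x y] that t
    by (simp add: vp_anticommute[of z] inner_commute)
  have "vp u z \<bullet> v = 0" using t inner_vp_swap[of u z v] by simp
  moreover have "vp v z \<bullet> u = 0" using t inner_vp_cycle[of u v z] by simp
  moreover have "vp (vp u v) z \<bullet> u = 0"
    using inner_vp_swap[of "vp u v" z u] vp_vp_same[of u v] t t' vp_anticommute[of u "vp u v"]
    by simp
  moreover have "vp (vp u v) z \<bullet> v = 0"
    using inner_vp_swap[of "vp u v" z v] vp_vp_same[of v u] t t' vp_anticommute[of v "vp u v"]
      vp_anticommute[of u v]
    by (simp add: vp_simps)
  moreover have "vp u v \<bullet> vp u z = 0" using t by (simp add: inner_vp_vp)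
  moreover have "vp u v \<bullet> vp v z = 0"
    using inner_vp_vp[of v u z] t t' vp_anticommute[of u v] by simp
  ultimately have "\<forall>i j. b $ i \<bullet> b $ j = (if i = j then 1 else 0)"
    unfolding forall_7 b
    using t t' norms right[of u v] right[of u "vp u v"] right[of v "vp u v"]
      right[of v u] right[of "vp u v" u] right[of "vp u v" v]
    by (simp add: inner_vp_left inner_vp_right inner_vp_left' inner_vp_right' inner_commute)
  then show ?thesis by (simp add: b_def)
qed

text \<open>The multiplication table has integer constants that do not depend on the Cayley triple; this is
  why all Cayley triples look alike. Products with \<open>u\<close>, \<open>v\<close>, \<open>uv\<close> are reduced by \<open>x(xy) = -y\<close> and
  by regrouping or exchanging orthogonal factors, which costs a sign; the product of two elements of
  the form \<open>xz\<close>, \<open>yz\<close> reduces to \<open>-xy\<close>.\<close>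

lemma cayley_table:
  assumes "cayley_triple vp s"
  defines "b \<equiv> cayley_basis vp s"
  shows "vp (b $ 1) (b $ 2) = b $ 3" "vp (b $ 1) (b $ 3) = - (b $ 2)" "vp (b $ 1) (b $ 4) = b $ 5"
    "vp (b $ 1) (b $ 5) = - (b $ 4)" "vp (b $ 1) (b $ 6) = - (b $ 7)" "vp (b $ 1) (b $ 7) = b $ 6"
    "vp (b $ 2) (b $ 3) = b $ 1" "vp (b $ 2) (b $ 4) = b $ 6" "vp (b $ 2) (b $ 5) = b $ 7"
    "vp (b $ 2) (b $ 6) = - (b $ 4)" "vp (b $ 2) (b $ 7) = - (b $ 5)"
    "vp (b $ 3) (b $ 4) = b $ 7" "vp (b $ 3) (b $ 5) = - (b $ 6)" "vp (b $ 3) (b $ 6) = b $ 5"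
    "vp (b $ 3) (b $ 7) = - (b $ 4)"
    "vp (b $ 4) (b $ 5) = b $ 1" "vp (b $ 4) (b $ 6) = b $ 2" "vp (b $ 4) (b $ 7) = b $ 3"
    "vp (b $ 5) (b $ 6) = - (b $ 3)" "vp (b $ 5) (b $ 7) = b $ 2" "vp (b $ 6) (b $ 7) = - (b $ 1)"
proof -
  obtain u v z where s: "s = (u, v, z)" by (cases s) auto
  have t: "u \<bullet> u = 1" "v \<bullet> v = 1" "z \<bullet> z = 1" "u \<bullet> v = 0" "u \<bullet> z = 0" "v \<bullet> z = 0" "vp u v \<bullet> z = 0"
    using assms by (auto simp: s cayley_triple_iff)
  have t': "v \<bullet> u = 0" "z \<bullet> u = 0" "z \<bullet> v = 0" "z \<bullet> vp u v = 0"
    using t by (simp_all add: inner_commute)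
  note b = cayley_basis_nth[of u v z, folded s, folded b_def]
  have o: "b $ i \<bullet> b $ j = (if i = j then 1 else 0)" for i j
    unfolding b_def by (rule cayley_basis_inner[OF assms(1)])
  have unit: "vp (b $ i) (vp (b $ i) (b $ j)) = - (b $ j)" if "i \<noteq> j" for i j
    using that by (simp add: vp_vp_same o)
  have assoc: "vp (b $ i) (vp (b $ j) (b $ k)) = - vp (vp (b $ i) (b $ j)) (b $ k)"
    if "i \<noteq> j" "i \<noteq> k" "j \<noteq> k" for i j k
    using that by (intro vp_vp_assoc) (simp_all add: o)
  have uv: "vp (b $ 2) (b $ 1) = - (b $ 3)"
    unfolding b by (rule vp_anticommute)
  show 12: "vp (b $ 1) (b $ 2) = b $ 3" and 14: "vp (b $ 1) (b $ 4) = b $ 5"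
    and 24: "vp (b $ 2) (b $ 4) = b $ 6" and 34: "vp (b $ 3) (b $ 4) = b $ 7"
    by (simp_all only: b)
  show 13: "vp (b $ 1) (b $ 3) = - (b $ 2)" using unit[of 1 2] 12 by simp
  show 15: "vp (b $ 1) (b $ 5) = - (b $ 4)" using unit[of 1 4] 14 by simp
  show 16: "vp (b $ 1) (b $ 6) = - (b $ 7)" using assoc[of 1 2 4] 24 12 34 by simp
  show 17: "vp (b $ 1) (b $ 7) = b $ 6" using unit[of 1 6] 16 by (simp add: vp_simps)
  show 23: "vp (b $ 2) (b $ 3) = b $ 1" using unit[of 2 1] uv by (simp add: vp_simps)
  show 25: "vp (b $ 2) (b $ 5) = b $ 7" using assoc[of 2 1 4] uv 14 34 by (simp add: vp_simps)
  show 26: "vp (b $ 2) (b $ 6) = - (b $ 4)" using unit[of 2 4] 24 by simp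
  show 27: "vp (b $ 2) (b $ 7) = - (b $ 5)" using unit[of 2 5] 25 by simp
  show 37: "vp (b $ 3) (b $ 7) = - (b $ 4)" using unit[of 3 4] 34 by simp
  have right: "vp (b $ 4) (vp (b $ i) (b $ 4)) = b $ i" if "i \<noteq> 4" for i
    using unit[of 4 i] that vp_anticommute[of "b $ 4" "b $ i"] by (simp add: vp_simps)
  show 45: "vp (b $ 4) (b $ 5) = b $ 1" and 46: "vp (b $ 4) (b $ 6) = b $ 2"
    and 47: "vp (b $ 4) (b $ 7) = b $ 3"
    using right[of 1] right[of 2] right[of 3] 14 24 34 by simp_all
  show 35: "vp (b $ 3) (b $ 5) = - (b $ 6)"
    using vp_vp_orthogonal[of "b $ 3" "b $ 1" "b $ 4"] 14 34 17 by (simp add: o)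
  show 36: "vp (b $ 3) (b $ 6) = b $ 5"
    using vp_vp_orthogonal[of "b $ 3" "b $ 2" "b $ 4"] 24 34 27 by (simp add: o)
  have common: "vp (vp (b $ i) (b $ 4)) (vp (b $ j) (b $ 4)) = - vp (b $ i) (b $ j)"
    if "i \<noteq> 4" "j \<noteq> 4" "i \<noteq> j" "b $ j \<bullet> vp (b $ i) (b $ 4) = 0" for i j
    using that by (intro vp_vp_common_right) (simp_all add: o)
  show "vp (b $ 5) (b $ 6) = - (b $ 3)" using common[of 1 2] 12 14 24 by (simp add: o)
  show "vp (b $ 5) (b $ 7) = b $ 2" using common[of 1 3] 13 14 34 by (simp add: o)
  show "vp (b $ 6) (b $ 7) = - (b $ 1)" using common[of 2 3] 23 24 34 by (simp add: o)
qed

end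

section \<open>Endomorphisms in an orthonormal frame\<close>

locale orthonormal_frame =
  fixes b :: "'v::euclidean_space ^ 'n::finite"
  assumes frame_inner: "b $ i \<bullet> b $ j = (if i = j then 1 else 0)"
    and frame_card: "CARD('n) = DIM('v)"
begin

definition coord :: "'v \<Rightarrow> real ^ 'n" where
  "coord x = (\<chi> i. x \<bullet> b $ i)"

definition comb :: "real ^ 'n \<Rightarrow> 'v" where
  "comb y = (\<Sum>i\<in>UNIV. y $ i *\<^sub>R b $ i)"

lemma frame_inj: "inj (\<lambda>k. b $ k)"
  by (rule injI) (metis frame_inner zero_neq_one)

lemma frame_independent: "independent (range (\<lambda>k. b $ k))"
proof (rule pairwise_orthogonal_independent)
  show "pairwise orthogonal (range (\<lambda>k. b $ k))"
    by (auto simp: pairwise_def orthogonal_def frame_inner)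
  show "0 \<notin> range (\<lambda>k. b $ k)"
    by (metis frame_inner inner_zero_left rangeE zero_neq_one)
qed

lemma frame_span: "span (range (\<lambda>k. b $ k)) = UNIV"
  using card_ge_dim_independent[of "range (\<lambda>k. b $ k)" UNIV] frame_independent
  by (simp add: card_image frame_inj frame_card top.extremum_unique)

lemma coord_comb: "coord (comb y) = y"
  by (simp add: vec_eq_iff coord_def comb_def inner_sum_left frame_inner if_distrib cong: if_cong)

lemma representation_frame: "representation (range (\<lambda>k. b $ k)) x (b $ i) = x \<bullet> b $ i"
  and comb_coord: "comb (coord x) = x"
proof -
  define r where "r = representation (range (\<lambda>k. b $ k)) x"
  have "(\<Sum>v\<in>range (\<lambda>k. b $ k). r v *\<^sub>R v) = x"
    unfolding r_def by (rule real_vector.sum_representation_eq) (auto simp: frame_independent frame_span)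
  then have x: "x = comb (\<chi> i. r (b $ i))"
    by (simp add: comb_def sum.reindex frame_inj)
  then have r: "(\<chi> i. r (b $ i)) = coord x"
    using coord_comb by metis
  then show "representation (range (\<lambda>k. b $ k)) x (b $ i) = x \<bullet> b $ i"
    by (simp add: vec_eq_iff coord_def r_def)
  show "comb (coord x) = x" using x r by simp
qed

lemma linear_comb: "linear comb"
  by (rule linearI) (simp_all add: comb_def scaleR_add_left sum.distrib scaleR_sum_right)

lemma coord_frame: "coord (b $ i) = axis i 1"
  by (auto simp: coord_def axis_def vec_eq_iff frame_inner)

lemma comb_axis: "comb (axis i 1) = b $ i"
  by (metis coord_frame comb_coord)

lemma matrix_in_basis_nth: "matrix_in_basis b \<delta> $ i $ j = \<delta> (b $ j) \<bullet> b $ i"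
  by (simp add: matrix_in_basis_def representation_frame)

lemma linear_coord: "linear coord"
  by (rule linearI) (simp_all add: coord_def vec_eq_iff inner_simps)

lemma coord_inner: "coord x \<bullet> coord y = x \<bullet> y"
proof -
  have "comb (coord x) \<bullet> y = coord x \<bullet> coord y"
    by (simp add: comb_def inner_sum_left inner_vec_def coord_def inner_commute[of y "b $ i" for i])
  then show ?thesis by (simp add: comb_coord)
qed

lemma comb_inner: "comb x \<bullet> comb y = x \<bullet> y"
  by (metis coord_inner coord_comb)

lemma coord_eq_iff: "coord x = coord y \<longleftrightarrow> x = y"
  by (metis comb_coord)

lemma matrix_in_basis_coord:
  assumes "linear \<delta>"
  shows "matrix_in_basis b \<delta> *v coord x = coord (\<delta> x)"
proof -
  interpret linear \<delta> by fact
  have "\<delta> x = (\<Sum>j\<in>UNIV. (x \<bullet> b $ j) *\<^sub>R \<delta> (b $ j))"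
    using comb_coord[of x] by (simp add: comb_def coord_def flip: sum scale)
  then show ?thesis
    by (simp add: vec_eq_iff matrix_vector_mult_def matrix_in_basis_nth coord_def inner_sum_left
        mult.commute)
qed

text \<open>Injectivity of \<open>\<delta> \<mapsto> [\<delta>]\<close>, which makes the inverse used by the action meaningful.\<close>

lemma matrix_in_basis_eqD:
  assumes "linear \<delta>" "linear \<epsilon>" "matrix_in_basis b \<delta> = matrix_in_basis b \<epsilon>"
  shows "\<delta> = \<epsilon>"
  by (metis assms matrix_in_basis_coord coord_eq_iff ext)

lemma the_inv_matrix_in_basis:
  assumes "\<delta> \<in> sym_endo"
  shows "the_inv_into sym_endo (matrix_in_basis b) (matrix_in_basis b \<delta>) = \<delta>"
proof (rule the_inv_into_f_f[OF _ assms])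
  show "inj_on (matrix_in_basis b) sym_endo"
    by (rule inj_onI) (auto simp: sym_endo_def intro: matrix_in_basis_eqD)
qed

end

section \<open>Symmetric endomorphisms with three simple eigenvalues\<close>

lemma orthonormal_3:
  "orthonormal [w1, w2, w3] \<longleftrightarrow>
     w1 \<bullet> w1 = 1 \<and> w2 \<bullet> w2 = 1 \<and> w3 \<bullet> w3 = 1 \<and> w1 \<bullet> w2 = 0 \<and> w1 \<bullet> w3 = 0 \<and> w2 \<bullet> w3 = 0"
  by (auto simp: orthonormal_def less_Suc_eq all_conj_distrib inner_commute
      numeral_nat)

lemma orthonormal_3D:
  assumes "orthonormal [w1, w2, w3]"
  shows "w1 \<bullet> w1 = 1" "w2 \<bullet> w2 = 1" "w3 \<bullet> w3 = 1" "w1 \<bullet> w2 = 0" "w1 \<bullet> w3 = 0" "w2 \<bullet> w3 = 0"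
    "w2 \<bullet> w1 = 0" "w3 \<bullet> w1 = 0" "w3 \<bullet> w2 = 0"
  using assms by (simp_all add: orthonormal_3 inner_commute)

text \<open>For orthonormal axes this has eigenvalue \<open>l\<^sub>i\<close> on the line of \<open>w\<^sub>i\<close> and \<open>mu\<close> on the
  orthogonal complement of the three axes. Written without reference to that complement, it is
  visibly compatible with isometries.\<close>

definition axis_endo ::
  "real \<Rightarrow> real \<Rightarrow> real \<Rightarrow> real \<Rightarrow> 'a::real_inner \<Rightarrow> 'a \<Rightarrow> 'a \<Rightarrow> 'a \<Rightarrow> 'a" where
  "axis_endo l1 l2 l3 mu w1 w2 w3 x =
     mu *\<^sub>R x + ((l1 - mu) * (w1 \<bullet> x)) *\<^sub>R w1 + ((l2 - mu) * (w2 \<bullet> x)) *\<^sub>R w2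
       + ((l3 - mu) * (w3 \<bullet> x)) *\<^sub>R w3"

lemma axis_endo_swap12: "axis_endo l1 l2 l3 mu w1 w2 w3 = axis_endo l2 l1 l3 mu w2 w1 w3"
  and axis_endo_swap13: "axis_endo l1 l2 l3 mu w1 w2 w3 = axis_endo l3 l2 l1 mu w3 w2 w1"
  by (auto simp: axis_endo_def fun_eq_iff)

lemma linear_axis_endo: "linear (axis_endo l1 l2 l3 mu w1 w2 w3)"
  by (rule linearI) (simp_all add: axis_endo_def inner_simps algebra_simps)

lemma sym_endo_axis_endo: "axis_endo l1 l2 l3 mu w1 w2 w3 \<in> sym_endo"
  unfolding sym_endo_def
  by (simp add: linear_axis_endo) (simp add: axis_endo_def inner_simps inner_commute algebra_simps)

lemma axis_endo_isometry:
  assumes "linear h" "\<And>x y. h x \<bullet> h y = x \<bullet> y"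
  shows "h (axis_endo l1 l2 l3 mu w1 w2 w3 x) = axis_endo l1 l2 l3 mu (h w1) (h w2) (h w3) (h x)"
  using assms by (simp add: axis_endo_def linear_add linear_scale)

lemma inner_axis_endo:
  assumes "orthonormal [w1, w2, w3]"
  shows "w1 \<bullet> axis_endo l1 l2 l3 mu w1 w2 w3 x = l1 * (w1 \<bullet> x)"
    and "w2 \<bullet> axis_endo l1 l2 l3 mu w1 w2 w3 x = l2 * (w2 \<bullet> x)"
    and "w3 \<bullet> axis_endo l1 l2 l3 mu w1 w2 w3 x = l3 * (w3 \<bullet> x)"
  by (simp_all add: orthonormal_3D[OF assms] axis_endo_def inner_simps algebra_simps)

lemma axis_endo_eigen_other:
  assumes "orthonormal [w1, w2, w3]" "l \<notin> {l1, l2, l3, mu}"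
    and x: "axis_endo l1 l2 l3 mu w1 w2 w3 x = l *\<^sub>R x"
  shows "x = 0"
proof -
  have "w1 \<bullet> x = 0" "w2 \<bullet> x = 0" "w3 \<bullet> x = 0"
    using inner_axis_endo[OF assms(1), of l1 l2 l3 mu x] assms(2) by (auto simp: x)
  then show ?thesis using x assms(2) by (simp add: axis_endo_def)
qed

lemma axis_endo_eigen_mu:
  assumes "orthonormal [w1, w2, w3]" "distinct [l1, l2, l3, mu]"
  shows "axis_endo l1 l2 l3 mu w1 w2 w3 x = mu *\<^sub>R x \<longleftrightarrow> w1 \<bullet> x = 0 \<and> w2 \<bullet> x = 0 \<and> w3 \<bullet> x = 0"
proof
  assume x: "axis_endo l1 l2 l3 mu w1 w2 w3 x = mu *\<^sub>R x"
  show "w1 \<bullet> x = 0 \<and> w2 \<bullet> x = 0 \<and> w3 \<bullet> x = 0"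
    using inner_axis_endo[OF assms(1), of l1 l2 l3 mu x] assms(2) by (auto simp: x)
qed (simp add: axis_endo_def)

lemma axis_endo_eigen_first:
  assumes "orthonormal [w1, w2, w3]" "distinct [l1, l2, l3, mu]"
  shows "axis_endo l1 l2 l3 mu w1 w2 w3 x = l1 *\<^sub>R x \<longleftrightarrow> x = (w1 \<bullet> x) *\<^sub>R w1"
proof
  assume x: "axis_endo l1 l2 l3 mu w1 w2 w3 x = l1 *\<^sub>R x"
  have "w2 \<bullet> x = 0" "w3 \<bullet> x = 0"
    using inner_axis_endo[OF assms(1), of l1 l2 l3 mu x] assms(2) by (auto simp: x)
  then have "mu *\<^sub>R x + ((l1 - mu) * (w1 \<bullet> x)) *\<^sub>R w1 = l1 *\<^sub>R x"
    using x by (simp add: axis_endo_def)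
  then have "(l1 - mu) *\<^sub>R (x - (w1 \<bullet> x) *\<^sub>R w1) = 0"
    by (simp add: algebra_simps)
  then show "x = (w1 \<bullet> x) *\<^sub>R w1" using assms(2) by simp
next
  assume x: "x = (w1 \<bullet> x) *\<^sub>R w1"
  have "axis_endo l1 l2 l3 mu w1 w2 w3 w1 = l1 *\<^sub>R w1"
    by (simp add: orthonormal_3D[OF assms(1)] axis_endo_def algebra_simps)
  then show "axis_endo l1 l2 l3 mu w1 w2 w3 x = l1 *\<^sub>R x"
    using linear_scale[OF linear_axis_endo, of l1 l2 l3 mu w1 w2 w3 "w1 \<bullet> x" w1] x
    by (metis scaleR_left_commute)
qed

lemma axis_endo_eigen:
  assumes "orthonormal [w1, w2, w3]" "distinct [l1, l2, l3, mu]"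
  shows "axis_endo l1 l2 l3 mu w1 w2 w3 x = l1 *\<^sub>R x \<longleftrightarrow> x = (w1 \<bullet> x) *\<^sub>R w1"
    and "axis_endo l1 l2 l3 mu w1 w2 w3 x = l2 *\<^sub>R x \<longleftrightarrow> x = (w2 \<bullet> x) *\<^sub>R w2"
    and "axis_endo l1 l2 l3 mu w1 w2 w3 x = l3 *\<^sub>R x \<longleftrightarrow> x = (w3 \<bullet> x) *\<^sub>R w3"
proof -
  show "axis_endo l1 l2 l3 mu w1 w2 w3 x = l1 *\<^sub>R x \<longleftrightarrow> x = (w1 \<bullet> x) *\<^sub>R w1"
    using assms by (rule axis_endo_eigen_first)
  show "axis_endo l1 l2 l3 mu w1 w2 w3 x = l2 *\<^sub>R x \<longleftrightarrow> x = (w2 \<bullet> x) *\<^sub>R w2"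
    using axis_endo_eigen_first[of w2 w1 w3 l2 l1 l3 mu x] assms
    by (auto simp: orthonormal_3 inner_commute axis_endo_swap12[of l1 l2])
  show "axis_endo l1 l2 l3 mu w1 w2 w3 x = l3 *\<^sub>R x \<longleftrightarrow> x = (w3 \<bullet> x) *\<^sub>R w3"
    using axis_endo_eigen_first[of w3 w2 w1 l3 l2 l1 mu x] assms
    by (auto simp: orthonormal_3 inner_commute axis_endo_swap13[of l1 l2 l3])
qed

text \<open>A simple eigenvalue determines its unit eigenvector up to sign, so the endomorphism determines
  the axes up to independent signs.\<close>

lemma axis_endo_unique:
  assumes o: "orthonormal [w1, w2, w3]" and o': "orthonormal [y1, y2, y3]"
    and d: "distinct [l1, l2, l3, mu]"
    and eq: "axis_endo l1 l2 l3 mu w1 w2 w3 = axis_endo l1 l2 l3 mu y1 y2 y3"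
  shows "y1 \<in> {w1, - w1}" "y2 \<in> {w2, - w2}" "y3 \<in> {w3, - w3}"
proof -
  have unit: "y \<in> {w, - w}" if "y = (w \<bullet> y) *\<^sub>R w" "w \<bullet> w = 1" "y \<bullet> y = 1" for w y :: 'a
  proof -
    have "(w \<bullet> y)\<^sup>2 = 1"
      using that by (metis inner_scaleR_left power2_eq_square inner_commute)
    then have "w \<bullet> y = 1 \<or> w \<bullet> y = - 1" by (simp add: power2_eq_1_iff)
    then show ?thesis using that(1) by auto
  qed
  have u: "w1 \<bullet> w1 = 1" "w2 \<bullet> w2 = 1" "w3 \<bullet> w3 = 1" "y1 \<bullet> y1 = 1" "y2 \<bullet> y2 = 1" "y3 \<bullet> y3 = 1"
    using o o' by (auto simp: orthonormal_3)
  have "y1 = (w1 \<bullet> y1) *\<^sub>R w1"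
    unfolding axis_endo_eigen(1)[OF o d, symmetric] eq axis_endo_eigen(1)[OF o' d] by (simp add: u)
  moreover have "y2 = (w2 \<bullet> y2) *\<^sub>R w2"
    unfolding axis_endo_eigen(2)[OF o d, symmetric] eq axis_endo_eigen(2)[OF o' d] by (simp add: u)
  moreover have "y3 = (w3 \<bullet> y3) *\<^sub>R w3"
    unfolding axis_endo_eigen(3)[OF o d, symmetric] eq axis_endo_eigen(3)[OF o' d] by (simp add: u)
  ultimately show "y1 \<in> {w1, - w1}" "y2 \<in> {w2, - w2}" "y3 \<in> {w3, - w3}"
    using u unit by auto
qed

lemma dim_orthogonal_complement_3:
  fixes w1 :: "'a::euclidean_space"
  assumes "orthonormal [w1, w2, w3]"
  shows "dim {x. w1 \<bullet> x = 0 \<and> w2 \<bullet> x = 0 \<and> w3 \<bullet> x = 0} + 3 = DIM('a)"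
proof -
  have ne: "w1 \<noteq> 0" "w2 \<noteq> 0" "w3 \<noteq> 0" "w1 \<noteq> w2" "w1 \<noteq> w3" "w2 \<noteq> w3"
    using assms by (auto simp: orthonormal_3)
  have "independent {w1, w2, w3}"
    using assms ne
    by (intro pairwise_orthogonal_independent)
      (auto simp: pairwise_def orthogonal_def orthonormal_3 inner_commute)
  then have "dim (span {w1, w2, w3}) = 3"
    using ne by (simp add: dim_eq_card_independent)
  moreover have "{x. w1 \<bullet> x = 0 \<and> w2 \<bullet> x = 0 \<and> w3 \<bullet> x = 0}
      = {y \<in> UNIV. \<forall>x\<in>span {w1, w2, w3}. orthogonal x y}"
  proof (intro set_eqI iffI)
    fix y assume "y \<in> {x. w1 \<bullet> x = 0 \<and> w2 \<bullet> x = 0 \<and> w3 \<bullet> x = 0}"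
    then have "orthogonal y x" if "x \<in> span {w1, w2, w3}" for x
      by (intro orthogonal_to_span[OF that]) (auto simp: orthogonal_def inner_commute)
    then show "y \<in> {y \<in> UNIV. \<forall>x\<in>span {w1, w2, w3}. orthogonal x y}"
      by (simp add: orthogonal_commute)
  qed (auto simp: orthogonal_def span_base)
  ultimately show ?thesis
    using dim_subspace_orthogonal_to_vectors[of "span {w1, w2, w3}" UNIV] by simp
qed

lemma spectral_type_axis_endo:
  fixes A :: "real ^ 'n ^ 'n"
  assumes o: "orthonormal [w1, w2, w3]" and d: "distinct [l1, l2, l3, mu]"
    and A: "\<And>x. A *v x = axis_endo l1 l2 l3 mu w1 w2 w3 x"
    and n: "CARD('n) = n + 3" "n > 0"
  shows "spectral_type A = {(l1, 1), (l2, 1), (l3, 1), (mu, n)}"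
proof -
  have line: "{x. x = (w \<bullet> x) *\<^sub>R w} = span {w} \<and> w \<noteq> 0" if "w \<bullet> w = 1" for w :: "real ^ 'n"
  proof -
    have "{x. x = (w \<bullet> x) *\<^sub>R w} = span {w}"
      using that by (auto simp: span_singleton)
    with that show ?thesis by auto
  qed
  have u: "w1 \<bullet> w1 = 1" "w2 \<bullet> w2 = 1" "w3 \<bullet> w3 = 1" using o by (auto simp: orthonormal_3)
  have E: "eigenspace A l1 = span {w1}" "eigenspace A l2 = span {w2}" "eigenspace A l3 = span {w3}"
    unfolding eigenspace_def A axis_endo_eigen[OF o d] using line u by simp_all
  have Emu: "dim (eigenspace A mu) = n"
    using dim_orthogonal_complement_3[OF o] n
    by (simp add: eigenspace_def A axis_endo_eigen_mu[OF o d])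
  have E0: "eigenspace A l \<subseteq> {0}" if "l \<notin> {l1, l2, l3, mu}" for l
    using axis_endo_eigen_other[OF o that] by (auto simp: eigenspace_def A)
  have ev: "eigenvalue A l \<longleftrightarrow> \<not> eigenspace A l \<subseteq> {0}" for l
    by (auto simp: eigenvalue_def eigenspace_def)
  have "\<not> eigenspace A mu \<subseteq> {0}"
    using Emu n(2) by (metis dim_eq_0 less_numeral_extra(3))
  moreover have "\<not> span {w} \<subseteq> {0}" if "w \<bullet> w = 1" for w :: "real ^ 'n"
    using that by (metis inner_zero_left insertI1 singletonD span_base subsetD zero_neq_one)
  ultimately have "eigenvalue A l \<longleftrightarrow> l \<in> {l1, l2, l3, mu}" for l
    using E0[of l] E u unfolding ev by auto
  moreover have "dim (span {w}) = 1" if "w \<bullet> w = 1" for w :: "real ^ 'n"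
    using line[OF that] by (simp add: dim_eq_card_independent)
  ultimately show ?thesis
    using E Emu u by (auto simp: spectral_type_def)
qed

text \<open>Eigenvectors of a symmetric matrix for different eigenvalues are orthogonal, so the eigenspace
  of \<open>mu\<close> lies in the complement of the three simple axes; its dimension leaves no room for a
  proper inclusion.\<close>

lemma axis_endo_of_spectral_type:
  fixes A :: "real ^ 'n ^ 'n"
  assumes sym: "transpose A = A" and d: "distinct [l1, l2, l3, mu]"
    and type: "spectral_type A = {(l1, 1), (l2, 1), (l3, 1), (mu, n)}"
    and n: "CARD('n) = n + 3"
  obtains w1 w2 w3 where "orthonormal [w1, w2, w3]"
    "\<And>x. A *v x = axis_endo l1 l2 l3 mu w1 w2 w3 x"
proof -
  have unit: "\<exists>w. w \<bullet> w = 1 \<and> A *v w = l *\<^sub>R w" if lk: "(l, k) \<in> spectral_type A" for l k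
  proof -
    obtain x where x: "x \<noteq> 0" "A *v x = l *\<^sub>R x"
      using lk by (auto simp: spectral_type_def eigenvalue_def)
    then have "(x /\<^sub>R norm x) \<bullet> (x /\<^sub>R norm x) = 1"
      by (simp add: dot_square_norm power2_eq_square)
    moreover have "A *v (x /\<^sub>R norm x) = l *\<^sub>R (x /\<^sub>R norm x)"
      using x(2) by (simp add: matrix_vector_mult_scaleR)
    ultimately show ?thesis by blast
  qed
  obtain w1 where w1: "w1 \<bullet> w1 = 1" "A *v w1 = l1 *\<^sub>R w1" using unit[of l1 1] type by auto
  obtain w2 where w2: "w2 \<bullet> w2 = 1" "A *v w2 = l2 *\<^sub>R w2" using unit[of l2 1] type by auto
  obtain w3 where w3: "w3 \<bullet> w3 = 1" "A *v w3 = l3 *\<^sub>R w3" using unit[of l3 1] type by auto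
  have orth: "x \<bullet> y = 0" if "A *v x = k *\<^sub>R x" "A *v y = l *\<^sub>R y" "k \<noteq> l" for x y k l
  proof -
    have "(A *v x) \<bullet> y = x \<bullet> (A *v y)"
      using dot_lmul_matrix[of x A y] sym by (metis vector_transpose_matrix)
    then show ?thesis using that by simp
  qed
  have o: "orthonormal [w1, w2, w3]"
    using orth[OF w1(2) w2(2)] orth[OF w1(2) w3(2)] orth[OF w2(2) w3(2)] w1 w2 w3 d
    by (simp add: orthonormal_3)
  define W where "W = {x. w1 \<bullet> x = 0 \<and> w2 \<bullet> x = 0 \<and> w3 \<bullet> x = 0}"
  have sub: "subspace (eigenspace A mu)"
    by (auto simp: subspace_def eigenspace_def matrix_vector_right_distrib matrix_vector_mult_scaleR
        algebra_simps)
  have "eigenspace A mu \<subseteq> W"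
    using orth[OF w1(2), of _ mu] orth[OF w2(2), of _ mu] orth[OF w3(2), of _ mu] d
    by (auto simp: W_def eigenspace_def)
  moreover have "subspace W" by (auto simp: W_def subspace_def inner_simps)
  moreover have "dim (eigenspace A mu) = n"
  proof -
    have "(mu, n) \<in> spectral_type A" using type by simp
    then show ?thesis by (auto simp: spectral_type_def)
  qed
  moreover have "dim W = n" using dim_orthogonal_complement_3[OF o] n by (simp add: W_def)
  ultimately have W: "eigenspace A mu = W"
    using sub subspace_dim_equal by (metis order_refl)
  have "A *v x = axis_endo l1 l2 l3 mu w1 w2 w3 x" for x
  proof -
    define y where "y = x - (w1 \<bullet> x) *\<^sub>R w1 - (w2 \<bullet> x) *\<^sub>R w2 - (w3 \<bullet> x) *\<^sub>R w3"
    have "y \<in> W"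
      by (simp add: W_def y_def inner_simps orthonormal_3D[OF o])
    then have y: "A *v y = mu *\<^sub>R y" using W by (auto simp: eigenspace_def)
    have x: "x = y + (w1 \<bullet> x) *\<^sub>R w1 + (w2 \<bullet> x) *\<^sub>R w2 + (w3 \<bullet> x) *\<^sub>R w3"
      by (simp add: y_def)
    have "A *v x = mu *\<^sub>R y + ((w1 \<bullet> x) * l1) *\<^sub>R w1 + ((w2 \<bullet> x) * l2) *\<^sub>R w2 + ((w3 \<bullet> x) * l3) *\<^sub>R w3"
      by (subst x) (simp add: matrix_vector_right_distrib matrix_vector_mult_scaleR y w1 w2 w3)
    also have "\<dots> = axis_endo l1 l2 l3 mu w1 w2 w3 x"
      by (simp add: y_def axis_endo_def algebra_simps)
    finally show ?thesis .
  qed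
  then show ?thesis using o that by blast
qed

section \<open>Transitivity on Cayley triples, and the action on endomorphisms\<close>

context vector_product_algebra
begin

lemma cayley_frame:
  assumes "DIM('v) = 7" "cayley_triple vp s"
  shows "orthonormal_frame (cayley_basis vp s)"
  by standard (simp_all add: assms cayley_basis_inner)

text \<open>The isometry that matches two Cayley bases is multiplicative, since both bases have the same
  multiplication table.\<close>

lemma G2_transitive:
  assumes dim: "DIM('v) = 7" and s: "cayley_triple vp s" and t: "cayley_triple vp t"
  obtains g where "g \<in> G2 vp" "\<And>i. g (cayley_basis vp s $ i) = cayley_basis vp t $ i"
proof -
  define b where "b = cayley_basis vp s"
  define c where "c = cayley_basis vp t"
  interpret B: orthonormal_frame b unfolding b_def using dim s by (rule cayley_frame)
  interpret C: orthonormal_frame c unfolding c_def using dim t by (rule cayley_frame)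
  define g where "g x = C.comb (B.coord x)" for x
  have gb: "g (b $ i) = c $ i" for i
    by (simp add: g_def B.coord_frame C.comb_axis)
  interpret g: linear g
    using linear_compose[OF B.linear_coord C.linear_comb] by (simp add: g_def[abs_def] o_def)
  have orth: "orthogonal_transformation g"
    by (simp add: orthogonal_transformation_def g.linear_axioms g_def B.coord_inner C.comb_inner)
  \<comment> \<open>By anticommutativity the products above the diagonal of the table suffice.\<close>
  define P where "P i j \<longleftrightarrow> g (vp (b $ i) (b $ j)) = vp (c $ i) (c $ j)" for i j
  have refl: "P i i" for i
    by (simp add: P_def vp_self g.zero)
  have sym: "P j i" if "P i j" for i j
    using that vp_anticommute[of "b $ i" "b $ j"] vp_anticommute[of "c $ i" "c $ j"]
    by (simp add: P_def g.neg)
  note tables = cayley_table[OF s, folded b_def] cayley_table[OF t, folded c_def]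
  have upper: "P 1 2" "P 1 3" "P 1 4" "P 1 5" "P 1 6" "P 1 7" "P 2 3" "P 2 4" "P 2 5" "P 2 6" "P 2 7"
    "P 3 4" "P 3 5" "P 3 6" "P 3 7" "P 4 5" "P 4 6" "P 4 7" "P 5 6" "P 5 7" "P 6 7"
    by (simp_all add: P_def tables g.neg gb)
  have "\<forall>i j. P i j"
    unfolding forall_7 using upper upper[THEN sym] refl by blast
  then have basis: "g (vp x y) = vp (g x) (g y)"
    if "x \<in> range (\<lambda>k. b $ k)" "y \<in> range (\<lambda>k. b $ k)" for x y
    using that by (auto simp: P_def gb)
  have "g (vp x y) = vp (g x) (g y)" for x y
  proof (rule bilinear_eq[of "\<lambda>x y. g (vp x y)" "\<lambda>x y. vp (g x) (g y)"
        UNIV "range (\<lambda>k. b $ k)" UNIV "range (\<lambda>k. b $ k)"])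
    show "bilinear (\<lambda>x y. g (vp x y))" "bilinear (\<lambda>x y. vp (g x) (g y))"
      by (auto simp: bilinear_def vp_simps g.add g.scale intro!: linearI)
  qed (simp_all only: B.frame_span basis subset_UNIV UNIV_I)
  then have "g \<in> G2 vp" using orth by (simp add: G2_def)
  then show ?thesis using that gb by (simp add: b_def c_def)
qed

text \<open>The component of \<open>w3\<close> orthogonal to \<open>w1 w2\<close> is also orthogonal to \<open>w1\<close> and \<open>w2\<close>. Normalised, and
  with the sign that matches the rotation in the normal form, it completes \<open>w1, w2\<close> to a Cayley
  triple; if it vanishes, any unit vector orthogonal to \<open>w1, w2, w1 w2\<close> will do.\<close>

lemma cayley_completion:
  assumes dim: "DIM('v) > 3" and o: "orthonormal [w1, w2, w3]"
  obtains z where "cayley_triple vp (w1, w2, z)"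
    "w3 = (vp w1 w2 \<bullet> w3) *\<^sub>R vp w1 w2 - sqrt (1 - (vp w1 w2 \<bullet> w3)\<^sup>2) *\<^sub>R z"
proof -
  define p where "p = vp w1 w2"
  define c where "c = p \<bullet> w3"
  define r where "r = w3 - c *\<^sub>R p"
  note o' = orthonormal_3D[OF o]
  have p: "p \<bullet> p = 1" "w1 \<bullet> p = 0" "w2 \<bullet> p = 0"
    using o' by (simp_all add: p_def inner_vp_vp inner_vp_left' inner_vp_right')
  have rr: "r \<bullet> r = 1 - c\<^sup>2"
    by (simp add: r_def inner_simps p o' c_def inner_commute[of w3 p] power2_eq_square)
  have r: "w1 \<bullet> r = 0" "w2 \<bullet> r = 0" "p \<bullet> r = 0"
    using p o' by (simp_all add: r_def inner_simps c_def)
  have norm_r: "norm r = sqrt (1 - c\<^sup>2)" by (simp add: norm_eq_sqrt_inner rr)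
  obtain z where z: "z \<bullet> z = 1" "w1 \<bullet> z = 0" "w2 \<bullet> z = 0" "p \<bullet> z = 0" "r = - (norm r *\<^sub>R z)"
  proof (cases "r = 0")
    case True
    have "dim {w1, w2, p} < DIM('v)"
      using dim_le_card'[of "{w1, w2, p}"] dim card_insert_le_m1[of 3 "{w2, p}" w1]
        card_insert_le_m1[of 2 "{p}" w2] by simp
    then obtain x where x: "x \<noteq> 0" "\<And>y. y \<in> span {w1, w2, p} \<Longrightarrow> orthogonal x y"
      using orthogonal_to_subspace_exists by blast
    have "x \<bullet> w1 = 0" "x \<bullet> w2 = 0" "x \<bullet> p = 0"
      using x(2) by (auto simp: orthogonal_def span_base)
    then show thesis
      using True x(1) that[of "x /\<^sub>R norm x"]
      by (simp add: inner_commute dot_square_norm power2_eq_square)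
  next
    case False
    then show thesis
      using r that[of "- (r /\<^sub>R norm r)"] by (simp add: dot_square_norm power2_eq_square)
  qed
  have "cayley_triple vp (w1, w2, z)"
    using z o' by (simp add: cayley_triple_iff p_def)
  moreover have "w3 = c *\<^sub>R p - sqrt (1 - c\<^sup>2) *\<^sub>R z"
    using z(5) unfolding norm_r by (simp add: r_def algebra_simps)
  ultimately show ?thesis using that by (simp add: c_def p_def)
qed

text \<open>Conjugation carries eigenvectors along: if the axes of \<open>\<delta>\<close> are the images under \<open>g\<close> of
  \<open>y1, y2, y3\<close>, then those of \<open>g\<^sup>-\<^sup>1 \<delta> g\<close> are \<open>y1, y2, y3\<close> themselves.\<close>

lemma G2_act_axis_endo:
  assumes dim: "DIM('v) = 7" and s: "cayley_triple vp s" and g: "g \<in> G2 vp"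
  shows "G2_act vp s (matrix_in_basis (cayley_basis vp s) (axis_endo l1 l2 l3 mu (g y1) (g y2) (g y3))) g
    = matrix_in_basis (cayley_basis vp s) (axis_endo l1 l2 l3 mu y1 y2 y3)"
proof -
  interpret orthonormal_frame "cayley_basis vp s" using dim s by (rule cayley_frame)
  have orth: "orthogonal_transformation g" using g by (simp add: G2_def)
  have "inj g" using orth by (rule orthogonal_transformation_inj)
  have "g (axis_endo l1 l2 l3 mu y1 y2 y3 x)
      = axis_endo l1 l2 l3 mu (g y1) (g y2) (g y3) (g x)" for x
    using orth by (intro axis_endo_isometry) (auto simp: orthogonal_transformation_def)
  then have "inv g \<circ> axis_endo l1 l2 l3 mu (g y1) (g y2) (g y3) \<circ> g = axis_endo l1 l2 l3 mu y1 y2 y3"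
    using \<open>inj g\<close> by (auto simp: fun_eq_iff inv_f_eq)
  then show ?thesis
    by (simp add: G2_act_def the_inv_matrix_in_basis sym_endo_axis_endo)
qed

end

section \<open>Matrices with the given eigenvalues, and the normal form\<close>

context orthonormal_frame
begin

lemma matrix_axis_endo_mult:
  "matrix_in_basis b (axis_endo l1 l2 l3 mu w1 w2 w3) *v y =
     axis_endo l1 l2 l3 mu (coord w1) (coord w2) (coord w3) y"
proof -
  have "matrix_in_basis b (axis_endo l1 l2 l3 mu w1 w2 w3) *v coord (comb y) =
      axis_endo l1 l2 l3 mu (coord w1) (coord w2) (coord w3) (coord (comb y))"
    by (simp only: matrix_in_basis_coord[OF linear_axis_endo]
        axis_endo_isometry[OF linear_coord coord_inner])
  then show ?thesis by (simp only: coord_comb)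
qed

lemma matrix_axis_endo_nth:
  "matrix_in_basis b (axis_endo l1 l2 l3 mu w1 w2 w3) $ i $ j =
     (if i = j then mu else 0) + (l1 - mu) * (w1 \<bullet> b $ i) * (w1 \<bullet> b $ j)
       + (l2 - mu) * (w2 \<bullet> b $ i) * (w2 \<bullet> b $ j) + (l3 - mu) * (w3 \<bullet> b $ i) * (w3 \<bullet> b $ j)"
  by (simp add: matrix_in_basis_nth axis_endo_def inner_simps frame_inner mult_ac)

text \<open>The passage from matrices to orthonormal triples of axes, which turns the orbit problem for
  matrices into one for such triples.\<close>

lemma matrices_of_type:
  assumes d: "distinct [l1, l2, l3, mu]" and n: "CARD('n) = n + 3" "n > 0"
  shows "A \<in> sym_matrices \<and> spectral_type A = {(l1, 1), (l2, 1), (l3, 1), (mu, n)} \<longleftrightarrow>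
    (\<exists>w1 w2 w3. orthonormal [w1, w2, w3] \<and> A = matrix_in_basis b (axis_endo l1 l2 l3 mu w1 w2 w3))"
    (is "?L \<longleftrightarrow> ?R")
proof
  assume ?L
  then obtain w1 w2 w3 where w: "orthonormal [w1, w2, w3]"
    "\<And>x. A *v x = axis_endo l1 l2 l3 mu w1 w2 w3 x"
    using axis_endo_of_spectral_type[OF _ d _ n(1), of A] by (auto simp: sym_matrices_def)
  have "A = matrix_in_basis b (axis_endo l1 l2 l3 mu (comb w1) (comb w2) (comb w3))"
    by (simp add: matrix_eq w(2) matrix_axis_endo_mult coord_comb)
  moreover have "orthonormal [comb w1, comb w2, comb w3]"
    using w(1) by (simp add: orthonormal_3 comb_inner)
  ultimately show ?R by blast
next
  assume ?R
  then obtain w1 w2 w3 where o: "orthonormal [w1, w2, w3]"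
    and A: "A = matrix_in_basis b (axis_endo l1 l2 l3 mu w1 w2 w3)"
    by blast
  have "orthonormal [coord w1, coord w2, coord w3]"
    using o by (simp add: orthonormal_3 coord_inner)
  then have "spectral_type A = {(l1, 1), (l2, 1), (l3, 1), (mu, n)}"
    by (rule spectral_type_axis_endo[OF _ d _ n]) (simp add: A matrix_axis_endo_mult)
  moreover have "transpose A = A"
    by (simp add: A vec_eq_iff transpose_def matrix_axis_endo_nth)
  ultimately show ?L by (simp add: sym_matrices_def)
qed

end

lemma matrix_inv_rot: "matrix_inv (rot \<alpha>) = rot (- \<alpha>)"
proof -
  have inv: "rot \<alpha> ** rot (- \<alpha>) = mat 1 \<and> rot (- \<alpha>) ** rot \<alpha> = mat 1"
    using sin_cos_squared_add[of \<alpha>]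
    by (simp add: rot_def matrix_matrix_mult_def vec_eq_iff forall_2 sum_2 mat_def
        power2_eq_square algebra_simps)
  have "matrix_inv (rot \<alpha>) ** rot \<alpha> = mat 1"
    unfolding matrix_inv_def
    using someI[of "\<lambda>A'. rot \<alpha> ** A' = mat 1 \<and> A' ** rot \<alpha> = mat 1", OF inv] by blast
  then have "(matrix_inv (rot \<alpha>) ** rot \<alpha>) ** rot (- \<alpha>) = rot (- \<alpha>)" by simp
  then show ?thesis
    unfolding matrix_mul_assoc[symmetric] conjunct1[OF inv] by simp
qed

lemma rotated_diag2:
  "matrix_inv (rot \<alpha>) ** diag2 l mu ** rot \<alpha> =
     vector [vector [mu + (l - mu) * (cos \<alpha>)\<^sup>2, - ((l - mu) * cos \<alpha> * sin \<alpha>)],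
             vector [- ((l - mu) * cos \<alpha> * sin \<alpha>), mu + (l - mu) * (sin \<alpha>)\<^sup>2]]"
proof -
  have "mu * (cos \<alpha> * cos \<alpha>) + mu * (sin \<alpha> * sin \<alpha>) = mu"
    using sin_cos_squared_add2[of \<alpha>] by (simp add: power2_eq_square flip: distrib_left)
  then show ?thesis
    unfolding matrix_inv_rot
    by (simp add: rot_def diag2_def matrix_matrix_mult_def vec_eq_iff forall_2 sum_2
        power2_eq_square algebra_simps)
qed

text \<open>In the normal form the axes are \<open>u\<close>, \<open>v\<close> and \<open>cos \<alpha> uv - sin \<alpha> z\<close>: the first row of
  \<open>R\<^sub>\<alpha>\<close> is the eigenvector of \<open>D\<close> for the simple eigenvalue.\<close>

lemma block_diag_eq_axis_endo:
  assumes "orthonormal_frame b"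
  shows "block_diag l1 l2 (matrix_inv (rot \<alpha>) ** diag2 l3 mu ** rot \<alpha>) (mu *\<^sub>R mat 1) =
    matrix_in_basis b (axis_endo l1 l2 l3 mu (b $ 1) (b $ 2) (cos \<alpha> *\<^sub>R b $ 3 - sin \<alpha> *\<^sub>R b $ 4))"
proof -
  interpret orthonormal_frame b by fact
  show ?thesis
    unfolding vec_eq_iff forall_7 rotated_diag2
    by (simp add: block_diag_def vector_7 matrix_axis_endo_nth inner_simps frame_inner mat_def
        power2_eq_square)
qed

theorem proposition3p2:
  fixes vp :: "'v::euclidean_space \<Rightarrow> 'v \<Rightarrow> 'v"
    and s :: "'v \<times> 'v \<times> 'v"
    and l1 l2 l3 mu :: real
  assumes "DIM('v) = 7"
    and "vector_product vp"
    and "cayley_triple vp s"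
    and "distinct [l1, l2, l3, mu]"
  shows "cross_section vp s {(l1, 1), (l2, 1), (l3, 1), (mu, 4)}
           {block_diag l1 l2 D (mu *\<^sub>R mat 1) | D.
              \<exists>\<alpha> \<in> {0..pi/2}. D = matrix_inv (rot \<alpha>) ** diag2 l3 mu ** rot \<alpha>}"
    (is "cross_section vp s ?p ?X")
proof -
  interpret vector_product_algebra vp by standard fact
  define b where "b = cayley_basis vp s"
  have frame: "orthonormal_frame b" unfolding b_def by (rule cayley_frame) fact+
  interpret orthonormal_frame b by (rule frame)
  define M where "M w1 w2 w3 = matrix_in_basis b (axis_endo l1 l2 l3 mu w1 w2 w3)" for w1 w2 w3
  define e where "e \<alpha> = cos \<alpha> *\<^sub>R b $ 3 - sin \<alpha> *\<^sub>R b $ 4" for \<alpha>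
  have X: "?X = {M (b $ 1) (b $ 2) (e \<alpha>) | \<alpha>. \<alpha> \<in> {0..pi/2}}"
    unfolding M_def e_def block_diag_eq_axis_endo[OF frame, symmetric] by blast
  have type: "A \<in> sym_of_type ?p \<longleftrightarrow> (\<exists>w1 w2 w3. orthonormal [w1, w2, w3] \<and> A = M w1 w2 w3)" for A
    using matrices_of_type[OF assms(4), of 4 A] by (simp add: sym_of_type_def M_def)
  have e: "orthonormal [b $ 1, b $ 2, e \<alpha>]" for \<alpha>
    by (simp add: orthonormal_3 e_def inner_simps frame_inner flip: power2_eq_square)
  have b3: "vp (b $ 1) (b $ 2) = b $ 3"
    unfolding b_def by (rule cayley_table) fact
  have act: "G2_act vp s (M (g y1) (g y2) (g y3)) g = M y1 y2 y3" if "g \<in> G2 vp" for g y1 y2 y3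
    using G2_act_axis_endo[OF assms(1,3) that] by (simp add: M_def b_def)
  \<comment> \<open>Under the sign condition a Cayley triple can be fitted to the axes, and transitivity
    carries the fixed triple to it.\<close>
  have exists: "\<exists>A. A \<in> ?X \<and> A \<in> G2_orbit vp s (M w1 w2 w3)"
    if o: "orthonormal [w1, w2, w3]" and pos: "vp w1 w2 \<bullet> w3 \<ge> 0" for w1 w2 w3
  proof -
    define \<alpha> where "\<alpha> = arccos (vp w1 w2 \<bullet> w3)"
    have le: "vp w1 w2 \<bullet> w3 \<le> 1"
      using norm_cauchy_schwarz[of "vp w1 w2" w3] orthonormal_3D[OF o]
      by (simp add: norm_eq_sqrt_inner inner_vp_vp)
    have cs: "cos \<alpha> = vp w1 w2 \<bullet> w3" "sin \<alpha> = sqrt (1 - (vp w1 w2 \<bullet> w3)\<^sup>2)"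
      using pos le by (simp_all add: \<alpha>_def sin_arccos)
    have \<alpha>: "\<alpha> \<in> {0..pi/2}"
      using pos le arccos_le_pi2 arccos_lbound by (auto simp: \<alpha>_def)
    obtain z where t: "cayley_triple vp (w1, w2, z)" and w3: "w3 = cos \<alpha> *\<^sub>R vp w1 w2 - sin \<alpha> *\<^sub>R z"
      using cayley_completion[OF _ o] assms(1) by (auto simp: cs)
    obtain g where g: "g \<in> G2 vp" "\<And>i. g (b $ i) = cayley_basis vp (w1, w2, z) $ i"
      unfolding b_def using G2_transitive[OF assms(1,3) t] by blast
    have "linear g" using g(1) by (simp add: G2_def orthogonal_transformation_def)
    then have "g (e \<alpha>) = w3"
      by (simp add: e_def w3 linear_diff linear_scale g(2) cayley_basis_nth)
    then have "G2_act vp s (M w1 w2 w3) g = M (b $ 1) (b $ 2) (e \<alpha>)"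
      using act[OF g(1), of "b $ 1" "b $ 2" "e \<alpha>"] by (simp add: g(2) cayley_basis_nth)
    then have "M (b $ 1) (b $ 2) (e \<alpha>) \<in> G2_orbit vp s (M w1 w2 w3)"
      using g(1) by (auto simp: G2_orbit_def intro!: exI[of _ g])
    then show ?thesis using \<alpha> unfolding X by blast
  qed
  \<comment> \<open>Automorphisms preserve the triple product of the axes; sign changes of the axes affect only
    its sign, hence the absolute value.\<close>
  have invariant: "cos \<alpha> = \<bar>vp w1 w2 \<bullet> w3\<bar>"
    if o: "orthonormal [w1, w2, w3]" and \<alpha>: "\<alpha> \<in> {0..pi/2}"
      and orbit: "M (b $ 1) (b $ 2) (e \<alpha>) \<in> G2_orbit vp s (M w1 w2 w3)" for w1 w2 w3 \<alpha>
  proof -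
    obtain g where g: "g \<in> G2 vp" and eq: "M (b $ 1) (b $ 2) (e \<alpha>) = G2_act vp s (M w1 w2 w3) g"
      using orbit by (auto simp: G2_orbit_def)
    have inner: "g x \<bullet> g y = x \<bullet> y" and mult: "vp (g x) (g y) = g (vp x y)" for x y
      using g by (auto simp: G2_def orthogonal_transformation_def)
    have "surj g" using g by (simp add: G2_def orthogonal_transformation_surj)
    then obtain y1 y2 y3 where y: "w1 = g y1" "w2 = g y2" "w3 = g y3" by (metis surjD)
    have "M (b $ 1) (b $ 2) (e \<alpha>) = M y1 y2 y3" using eq act[OF g] by (simp add: y)
    then have endo: "axis_endo l1 l2 l3 mu (b $ 1) (b $ 2) (e \<alpha>) = axis_endo l1 l2 l3 mu y1 y2 y3"
      unfolding M_def by (intro matrix_in_basis_eqD linear_axis_endo)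
    have "orthonormal [y1, y2, y3]" using o by (simp add: y orthonormal_3 inner)
    note signs = axis_endo_unique[OF e this assms(4) endo]
    have "vp w1 w2 \<bullet> w3 = vp y1 y2 \<bullet> y3" by (simp add: y mult inner)
    also have "\<bar>vp y1 y2 \<bullet> y3\<bar> = \<bar>vp (b $ 1) (b $ 2) \<bullet> e \<alpha>\<bar>"
      using signs by (auto simp: vp_simps)
    also have "\<dots> = \<bar>cos \<alpha>\<bar>" by (simp add: b3 e_def inner_simps frame_inner)
    also have "\<dots> = cos \<alpha>" using \<alpha> cos_ge_zero[of \<alpha>] by simp
    finally show ?thesis by simp
  qed
  have unique: "\<exists>!A. A \<in> ?X \<and> A \<in> G2_orbit vp s (M w1 w2 w3)"
    if o: "orthonormal [w1, w2, w3]" for w1 w2 w3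
  proof (rule ex_ex1I)
    show "\<exists>A. A \<in> ?X \<and> A \<in> G2_orbit vp s (M w1 w2 w3)"
    proof (cases "vp w1 w2 \<bullet> w3 \<ge> 0")
      case True
      with o show ?thesis by (rule exists)
    next
      case False
      \<comment> \<open>Reversing an axis changes the sign of the triple product, but not the matrix.\<close>
      then have "\<exists>A. A \<in> ?X \<and> A \<in> G2_orbit vp s (M w1 w2 (- w3))"
        using o by (intro exists) (simp_all add: orthonormal_3)
      moreover have "M w1 w2 (- w3) = M w1 w2 w3"
        by (simp add: M_def axis_endo_def[abs_def])
      ultimately show ?thesis by simp
    qed
  next
    fix A B
    assume A: "A \<in> ?X \<and> A \<in> G2_orbit vp s (M w1 w2 w3)"
      and B: "B \<in> ?X \<and> B \<in> G2_orbit vp s (M w1 w2 w3)"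
    obtain \<alpha> where \<alpha>: "\<alpha> \<in> {0..pi/2}" "A = M (b $ 1) (b $ 2) (e \<alpha>)" using A unfolding X by blast
    obtain \<beta> where \<beta>: "\<beta> \<in> {0..pi/2}" "B = M (b $ 1) (b $ 2) (e \<beta>)" using B unfolding X by blast
    have "cos \<alpha> = cos \<beta>" using invariant[OF o] A B \<alpha> \<beta> by metis
    then have "\<alpha> = \<beta>" using \<alpha>(1) \<beta>(1) cos_inj_pi[of \<alpha> \<beta>] by auto
    then show "A = B" using \<alpha> \<beta> by simp
  qed
  have "\<forall>Q\<in>G2_orbit vp s ` sym_of_type ?p. \<exists>!A. A \<in> ?X \<and> A \<in> Q"
  proof
    fix Q assume "Q \<in> G2_orbit vp s ` sym_of_type ?p"
    then obtain A where "A \<in> sym_of_type ?p" "Q = G2_orbit vp s A" by (rule imageE)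
    moreover from this obtain w1 w2 w3 where "orthonormal [w1, w2, w3]" "A = M w1 w2 w3"
      unfolding type by blast
    ultimately show "\<exists>!A. A \<in> ?X \<and> A \<in> Q" using unique by simp
  qed
  moreover have "?X \<subseteq> sym_of_type ?p"
    unfolding X using e type by blast
  ultimately show ?thesis by (simp add: cross_section_def)
qed

end
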